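(* Let $d \geq 2$ and let $\mathbb{E}^d$ be a $d$-dimensional Euclidean space, identified with $\mathbb{R}^d$ via fixed orthonormal coordinates. Let $\Omega \subset \mathbb{E}^d$ be a lattice of rank $d$ with determinant $\Delta$ (the volume of a fundamental domain). Let $s \geq 1$ and let $\Lambda_1,\dots,\Lambda_s \subset \Omega$ be sublattices of finite indices $D_1,\dots,D_s \geq 2$ respectively, and assume that $\Omega \not\subseteq \bigcup_{i=1}^s \Lambda_i$. Let $\Lambda = \bigcap_{i=1}^s \Lambda_i$ and $D = D_1 \cdots D_s$. Let $P(x_1,\dots,x_d) \in \mathbb{R}[x_1,\dots,x_d]$ be a nonzero polynomial of degree $m$. Then there exists $$\boldsymbol{z} \in \Omega \setminus \left( \bigcup_{i=1}^s \Lambda_i \right)$$ such that $P(\boldsymbol{z}) \neq 0$ and $$|\boldsymbol{z}| \leq \frac{d(D(m+2)+2) D\Delta}{2\lambda_1(\Lambda)^{d-1}} \max \left\{ 1, \frac{2^d}{\operatorname{Vol}_d(C_d(1))} \left( \sum_{i=1}^s \frac{1}{D_i} - \frac{s - 1}{D} + \frac{\lambda_1(\Lambda)^d}{D\Delta} \right) \right\}.$$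
   Context: For $\boldsymbol{z} \in \mathbb{E}^d$, $|\boldsymbol{z}| = \max_{1 \leq i \leq d} |z_i|$ is the sup-norm, and $C_d(T) = \{\boldsymbol{z} \in \mathbb{E}^d : |\boldsymbol{z}| \leq T\}$ for $T>0$; $\operatorname{Vol}_d$ denotes $d$-dimensional Lebesgue measure. For a full-rank lattice $L \subset \mathbb{E}^d$, its successive minima with respect to $C_d(1)$ are $\lambda_i(L) = \min\{T > 0 : \dim_{\mathbb{R}} \operatorname{span}_{\mathbb{R}}(C_d(T) \cap L) \geq i\}$, $1 \leq i \leq d$. *)

theory Defs
  imports "HOL-Analysis.Analysis" "HOL-Library.Poly_Mapping"
begin

definition int_span :: "(real^'n) set \<Rightarrow> (real^'n) set" where
  "int_span B = {\<Sum>b\<in>B. of_int (c b) *\<^sub>R b | c :: real^'n \<Rightarrow> int. True}"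

definition lattice_basis :: "(real^'n) set \<Rightarrow> (real^'n) set \<Rightarrow> bool" where
  "lattice_basis B L \<longleftrightarrow> independent B \<and> L = int_span B"

text \<open>Lattices of arbitrary rank; the rank of \<open>L\<close> is \<open>dim L\<close>, the dimension of its real span.\<close>

definition is_lattice :: "(real^'n) set \<Rightarrow> bool" where
  "is_lattice L \<longleftrightarrow> (\<exists>B. lattice_basis B L)"

definition fundamental_parallelepiped :: "(real^'n) set \<Rightarrow> (real^'n) set" where
  "fundamental_parallelepiped B =
     {\<Sum>b\<in>B. c b *\<^sub>R b | c :: real^'n \<Rightarrow> real. \<forall>b\<in>B. 0 \<le> c b \<and> c b < 1}"

text \<open>The value does not depend on the chosen basis. It is the lattice determinant only for
  lattices of full rank (otherwise it is \<open>0\<close>).\<close>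

definition lattice_det :: "(real^'n) set \<Rightarrow> real" where
  "lattice_det L = measure lebesgue (fundamental_parallelepiped (SOME B. lattice_basis B L))"

definition lattice_cosets :: "(real^'n) set \<Rightarrow> (real^'n) set \<Rightarrow> (real^'n) set set" where
  "lattice_cosets L M = (\<lambda>x. (\<lambda>y. x + y) ` M) ` L"

definition sublattice_of_index :: "(real^'n) set \<Rightarrow> (real^'n) set \<Rightarrow> nat \<Rightarrow> bool" where
  "sublattice_of_index M L k \<longleftrightarrow>
     is_lattice M \<and> M \<subseteq> L \<and> finite (lattice_cosets L M) \<and> card (lattice_cosets L M) = k"

definition sup_cube :: "real \<Rightarrow> (real^'n) set" where
  "sup_cube T = {z. infnorm z \<le> T}"

definition successive_minimum :: "nat \<Rightarrow> (real^'n) set \<Rightarrow> real" where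
  "successive_minimum i L = (LEAST T. T > 0 \<and> dim (span (sup_cube T \<inter> L)) \<ge> i)"

text \<open>Real polynomials in variables indexed by \<open>'n\<close> are finitely supported maps from exponent
  vectors to coefficients.\<close>

type_synonym 'n real_mpoly = "('n \<Rightarrow>\<^sub>0 nat) \<Rightarrow>\<^sub>0 real"

definition mpoly_eval :: "'n::finite real_mpoly \<Rightarrow> real^'n \<Rightarrow> real" where
  "mpoly_eval P z =
     (\<Sum>\<alpha>\<in>Poly_Mapping.keys P. Poly_Mapping.lookup P \<alpha> * (\<Prod>i\<in>UNIV. (z $ i) ^ Poly_Mapping.lookup \<alpha> i))"

text \<open>Meaningful only for nonzero \<open>P\<close>.\<close>

definition mpoly_degree :: "'n::finite real_mpoly \<Rightarrow> nat" where
  "mpoly_degree P = Max ((\<lambda>\<alpha>. \<Sum>i\<in>UNIV. Poly_Mapping.lookup \<alpha> i) ` Poly_Mapping.keys P)"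

end

theory Submission imports Defs begin

text \<open>Let \<open>\<mu>\<close> be the last successive minimum of \<open>\<Lambda>\<close> and \<open>v\<^sub>1, \<dots>, v\<^sub>d\<close> linearly
  independent vectors of \<open>\<Lambda>\<close> of norm at most \<open>\<mu>\<close>. Since \<open>\<Lambda>\<close> has index at most \<open>D\<close>,
  \<open>\<mu> \<lambda>\<^sub>1(\<Lambda>)\<^bsup>d-1\<^esup> \<le> D \<Delta>\<close> by a volume argument in the style of Minkowski. Take a
  point \<open>y\<close> of \<open>\<Omega>\<close> outside all \<open>\<Lambda>\<^sub>i\<close>. Every point \<open>y + \<Sum> c\<^sub>i v\<^sub>i\<close> with integers
  \<open>c\<^sub>i\<close> avoids the \<open>\<Lambda>\<^sub>i\<close> too, and letting each \<open>c\<^sub>i\<close> range over \<open>m + 1\<close> consecutive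
  integers keeps all its coordinates with respect to the \<open>v\<^sub>i\<close> in an interval
  \<open>[-(m+1)/2, (m+1)/2]\<close>. A nonzero polynomial of degree \<open>m\<close> cannot vanish on such a grid, so
  some point of norm at most \<open>d (m+1) \<mu> / 2\<close> satisfies all requirements.\<close>

section \<open>Polynomials on grids\<close>

text \<open>Induction on the variables. With all variables but \<open>z j\<close> frozen, the sum is
  a univariate polynomial that vanishes everywhere, so its coefficient at \<open>\<alpha> j\<close>
  vanishes; that coefficient is a sum of the same shape over \<open>I\<close>. The assumption that
  exponents in \<open>K\<close> are separated by \<open>I\<close> passes to \<open>K'\<close>, whose
  members agree at \<open>j\<close>, and makes the base case a single term.\<close>

lemma monomial_sums_independent:
  fixes c :: "('i \<Rightarrow> nat) \<Rightarrow> real"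
  assumes "finite I" "finite K" "\<And>\<beta> \<gamma>. \<beta> \<in> K \<Longrightarrow> \<gamma> \<in> K \<Longrightarrow> (\<forall>i\<in>I. \<beta> i = \<gamma> i) \<Longrightarrow> \<beta> = \<gamma>"
    and "\<And>z. (\<Sum>\<alpha>\<in>K. c \<alpha> * (\<Prod>i\<in>I. z i ^ \<alpha> i)) = 0"
    and "\<alpha> \<in> K"
  shows "c \<alpha> = 0"
  using assms
proof (induction I arbitrary: K \<alpha> rule: finite_induct)
  case empty
  then have "K = {\<alpha>}" by auto
  with empty.prems(3) show ?case by simp
next
  case (insert j I)
  define K' where "K' = {\<beta> \<in> K. \<beta> j = \<alpha> j}"
  have "\<beta> = \<gamma>" if "\<beta> \<in> K'" "\<gamma> \<in> K'" "\<forall>i\<in>I. \<beta> i = \<gamma> i" for \<beta> \<gamma>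
    using that insert.prems(2)[of \<beta> \<gamma>] by (simp add: K'_def)
  moreover have "(\<Sum>\<beta>\<in>K'. c \<beta> * (\<Prod>i\<in>I. z i ^ \<beta> i)) = 0" for z
  proof -
    define p where "p = (\<Sum>\<beta>\<in>K. monom (c \<beta> * (\<Prod>i\<in>I. z i ^ \<beta> i)) (\<beta> j))"
    have "poly p t = 0" for t
    proof -
      have "(\<Prod>i\<in>insert j I. (z(j := t)) i ^ \<beta> i) = t ^ \<beta> j * (\<Prod>i\<in>I. z i ^ \<beta> i)" for \<beta>
      proof -
        have "(\<Prod>i\<in>I. (z(j := t)) i ^ \<beta> i) = (\<Prod>i\<in>I. z i ^ \<beta> i)"
          using insert.hyps by (intro prod.cong) auto
        then show ?thesis using insert.hyps by simp
      qed
      with insert.prems(3)[of "z(j := t)"] show ?thesis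
        by (simp add: p_def poly_sum poly_monom mult_ac del: fun_upd_apply)
    qed
    then have "p = 0" using poly_all_0_iff_0 by blast
    then have "0 = coeff p (\<alpha> j)" by simp
    also have "\<dots> = (\<Sum>\<beta>\<in>K. if \<beta> j = \<alpha> j then c \<beta> * (\<Prod>i\<in>I. z i ^ \<beta> i) else 0)"
      by (simp add: p_def coeff_sum)
    also have "\<dots> = (\<Sum>\<beta>\<in>K'. c \<beta> * (\<Prod>i\<in>I. z i ^ \<beta> i))"
      using insert.prems(1) by (simp add: K'_def sum.inter_filter)
    finally show ?thesis by simp
  qed
  ultimately show ?case
    using insert.prems by (intro insert.IH[of K' \<alpha>]) (auto simp: K'_def)
qed

lemma mpoly_eval_not_identically_zero:
  fixes P :: "'n::finite real_mpoly"
  assumes "P \<noteq> 0"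
  shows "\<exists>z. mpoly_eval P z \<noteq> 0"
proof (rule ccontr)
  assume "\<not> ?thesis"
  then have zero: "mpoly_eval P z = 0" for z by blast
  let ?l = "Poly_Mapping.lookup :: ('n \<Rightarrow>\<^sub>0 nat) \<Rightarrow> 'n \<Rightarrow> nat"
  have inj: "inj ?l" by (rule injI) (rule poly_mapping_eqI, rule fun_cong)
  obtain \<alpha> where \<alpha>: "\<alpha> \<in> Poly_Mapping.keys P"
    using assms keys_eq_empty[of P] by blast
  \<comment> \<open>Exponent vectors become plain functions through the injection \<open>?l\<close>,
    so that independence of monomials applies to them.\<close>
  define c where "c \<beta> = Poly_Mapping.lookup P (inv ?l \<beta>)" for \<beta>
  have c: "c (?l \<beta>) = Poly_Mapping.lookup P \<beta>" for \<beta>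
    by (simp add: c_def inj)
  have "c (?l \<alpha>) = 0"
  proof (rule monomial_sums_independent[where I = UNIV and K = "?l ` Poly_Mapping.keys P"])
    show "(\<Sum>\<beta>\<in>?l ` Poly_Mapping.keys P. c \<beta> * (\<Prod>i\<in>UNIV. z i ^ \<beta> i)) = 0" for z
      using zero[of "\<chi> i. z i"]
      by (subst sum.reindex[OF inj_on_subset[OF inj]]) (simp_all add: mpoly_eval_def c)
  qed (use \<alpha> in \<open>auto simp: fun_eq_iff\<close>)
  with \<alpha> show False by (simp add: c in_keys_iff)
qed

text \<open>Along a line every monomial is a product of affine factors in \<open>t\<close>, as many
  as its total degree. The grid argument sees the degree of \<open>P\<close> only through this
  fact.\<close>

lemma mpoly_eval_on_line:
  fixes P :: "'n::finite real_mpoly"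
  shows "\<exists>p. degree p \<le> mpoly_degree P \<and> (\<forall>t. mpoly_eval P (x + t *\<^sub>R u) = poly p t)"
proof (intro exI conjI allI)
  define p where "p = (\<Sum>\<alpha>\<in>Poly_Mapping.keys P. smult (Poly_Mapping.lookup P \<alpha>)
     (\<Prod>i\<in>UNIV. [:x $ i, u $ i:] ^ Poly_Mapping.lookup \<alpha> i))"
  show "mpoly_eval P (x + t *\<^sub>R u) = poly p t" for t
    by (simp add: p_def mpoly_eval_def poly_sum poly_prod)
  show "degree p \<le> mpoly_degree P"
    unfolding p_def
  proof (rule degree_sum_le)
    fix \<alpha> assume "\<alpha> \<in> Poly_Mapping.keys P"
    have "degree (smult (Poly_Mapping.lookup P \<alpha>) (\<Prod>i\<in>UNIV. [:x $ i, u $ i:] ^ Poly_Mapping.lookup \<alpha> i))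
        \<le> degree (\<Prod>i\<in>UNIV. [:x $ i, u $ i:] ^ Poly_Mapping.lookup \<alpha> i)"
      by (rule degree_smult_le)
    also have "\<dots> \<le> (\<Sum>i\<in>UNIV. degree ([:x $ i, u $ i:] ^ Poly_Mapping.lookup \<alpha> i))"
      by (rule order_trans[OF degree_prod_sum_le]) auto
    also have "\<dots> \<le> (\<Sum>i\<in>UNIV. Poly_Mapping.lookup \<alpha> i)"
    proof (rule sum_mono)
      fix i
      show "degree ([:x $ i, u $ i:] ^ Poly_Mapping.lookup \<alpha> i) \<le> Poly_Mapping.lookup \<alpha> i"
        by (rule order_trans[OF degree_power_le]) simp
    qed
    also have "\<dots> \<le> mpoly_degree P"
      unfolding mpoly_degree_def using \<open>\<alpha> \<in> _\<close> by (intro Max_ge) auto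
    finally show "degree (smult (Poly_Mapping.lookup P \<alpha>) (\<Prod>i\<in>UNIV. [:x $ i, u $ i:] ^ Poly_Mapping.lookup \<alpha> i))
        \<le> mpoly_degree P" .
  qed auto
qed

text \<open>Induction on the directions. For each of the more than \<open>m\<close> values
  \<open>t\<close> in \<open>C v\<close>, the induction hypothesis at base point
  \<open>y + t *\<^sub>R v\<close> gives zeros for all real coefficients in the other directions.
  The restriction of \<open>f\<close> to any line in direction \<open>v\<close> then has too many
  roots for its degree. The base point moves, so \<open>y\<close> is generalized.\<close>

lemma vanishing_on_grid_imp_vanishing_on_span:
  fixes f :: "'a::real_vector \<Rightarrow> real"
  assumes "finite B"
    and line: "\<And>x u. \<exists>p. degree p \<le> m \<and> (\<forall>t. f (x + t *\<^sub>R u) = poly p t)"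
    and C: "\<And>b. b \<in> B \<Longrightarrow> finite (C b) \<and> card (C b) > m"
    and "\<And>c. (\<And>b. b \<in> B \<Longrightarrow> c b \<in> C b) \<Longrightarrow> f (y + (\<Sum>b\<in>B. c b *\<^sub>R b)) = 0"
  shows "f (y + (\<Sum>b\<in>B. c b *\<^sub>R b)) = 0"
  using assms(1,3,4)
proof (induction B arbitrary: y rule: finite_induct)
  case empty
  then show ?case by simp
next
  case (insert v B)
  obtain p where p: "degree p \<le> m" 
      "\<And>t. f ((y + (\<Sum>b\<in>B. c b *\<^sub>R b)) + t *\<^sub>R v) = poly p t"
    using line by blast
  have "poly p t = 0" if "t \<in> C v" for t
  proof -
    have "f ((y + t *\<^sub>R v) + (\<Sum>b\<in>B. c b *\<^sub>R b)) = 0"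
    proof (rule insert.IH)
      fix c assume c: "\<And>b. b \<in> B \<Longrightarrow> c b \<in> C b"
      have "(\<Sum>b\<in>B. (c(v := t)) b *\<^sub>R b) = (\<Sum>b\<in>B. c b *\<^sub>R b)"
        using insert.hyps by (intro sum.cong) auto
      then have "(\<Sum>b\<in>insert v B. (c(v := t)) b *\<^sub>R b) = t *\<^sub>R v + (\<Sum>b\<in>B. c b *\<^sub>R b)"
        using insert.hyps by simp
      moreover have "f (y + (\<Sum>b\<in>insert v B. (c(v := t)) b *\<^sub>R b)) = 0"
        by (rule insert.prems) (use c that in auto)
      ultimately show "f ((y + t *\<^sub>R v) + (\<Sum>b\<in>B. c b *\<^sub>R b)) = 0"
        by (simp add: add.assoc)
    qed (use insert.prems in auto)
    then show ?thesis using p(2)[of t] by (simp add: algebra_simps)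
  qed
  then have sub: "C v \<subseteq> {t. poly p t = 0}" by auto
  have "p = 0"
  proof (rule ccontr)
    assume "p \<noteq> 0"
    then have "card (C v) \<le> degree p"
      using card_mono[OF poly_roots_finite sub] card_poly_roots_bound by fastforce
    with p(1) insert.prems(1)[of v] show False by simp
  qed
  with p(2)[of "c v"] insert.hyps show ?case by (simp add: algebra_simps)
qed

section \<open>Subgroups of a lattice\<close>

text \<open>Unlike the existence of a lattice basis, this property passes to intersections at once,
  so no basis of \<Lambda> has to be constructed.\<close>

definition additive_subgroup :: "'a::group_add set \<Rightarrow> bool" where
  "additive_subgroup L \<longleftrightarrow> 0 \<in> L \<and> (\<forall>x\<in>L. \<forall>y\<in>L. x - y \<in> L)"

lemma additive_subgroup_int_span: "additive_subgroup (int_span B)"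
  unfolding additive_subgroup_def
proof (intro conjI ballI)
  show "0 \<in> int_span B"
    by (auto simp: int_span_def intro!: exI[of _ "\<lambda>_. 0"])
  fix x y assume "x \<in> int_span B" "y \<in> int_span B"
  then obtain c c' where "x = (\<Sum>b\<in>B. of_int (c b) *\<^sub>R b)" "y = (\<Sum>b\<in>B. of_int (c' b) *\<^sub>R b)"
    by (auto simp: int_span_def)
  then show "x - y \<in> int_span B"
    by (auto simp: int_span_def sum_subtractf algebra_simps intro!: exI[of _ "\<lambda>b. c b - c' b"])
qed

lemma additive_subgroup_add:
  fixes L :: "'a::ab_group_add set"
  assumes "additive_subgroup L" "x \<in> L" "y \<in> L"
  shows "x + y \<in> L"
proof -
  have "x - (0 - y) \<in> L" using assms unfolding additive_subgroup_def by blast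
  then show ?thesis by simp
qed

lemma additive_subgroup_of_int_scaleR:
  fixes L :: "'a::real_vector set"
  assumes "additive_subgroup L" "x \<in> L"
  shows "of_int k *\<^sub>R x \<in> L"
proof -
  have nat: "real n *\<^sub>R x \<in> L" for n
  proof (induction n)
    case 0
    then show ?case using assms by (simp add: additive_subgroup_def)
  next
    case (Suc n)
    then show ?case using additive_subgroup_add[OF assms(1) assms(2) Suc] by (simp add: algebra_simps)
  qed
  show ?thesis
  proof (cases "k \<ge> 0")
    case True
    then show ?thesis using nat[of "nat k"] by simp
  next
    case False
    have "0 - real (nat (- k)) *\<^sub>R x \<in> L"
      using nat assms(1) unfolding additive_subgroup_def by blast
    with False show ?thesis by simp
  qed
qed

lemma additive_subgroup_sum:
  fixes L :: "'a::ab_group_add set"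
  assumes "additive_subgroup L" "\<And>i. i \<in> I \<Longrightarrow> f i \<in> L"
  shows "sum f I \<in> L"
  using assms(2)
proof (induction I rule: infinite_finite_induct)
  case (insert i I)
  then show ?case using additive_subgroup_add[OF assms(1)] by simp
qed (use assms(1) in \<open>auto simp: additive_subgroup_def\<close>)

section \<open>Coordinates and discreteness of lattices\<close>

lemma representation_sum_scaleR:
  fixes B :: "'a::real_vector set"
  assumes "independent B'" "B \<subseteq> B'" "finite B" "b \<in> B"
  shows "representation B' (\<Sum>v\<in>B. c v *\<^sub>R v) b = c b"
proof -
  have "v \<in> span B'" if "v \<in> B" for v using that assms(2) by (auto intro: span_base)
  then have "representation B' (\<Sum>v\<in>B. c v *\<^sub>R v) b = (\<Sum>v\<in>B. c v * representation B' v b)"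
    using assms by (simp add: representation_sum representation_scale span_scale)
  also have "\<dots> = (\<Sum>v\<in>B. if v = b then c v else 0)"
    using assms by (intro sum.cong) (auto simp: representation_basis)
  also have "\<dots> = c b" using assms by simp
  finally show ?thesis .
qed

text \<open>Coordinates are bounded on a bounded set, which leaves finitely many integer coordinate
  vectors.\<close>

lemma finite_bounded_int_span:
  fixes B :: "(real^'n) set"
  assumes "independent B" "bounded X"
  shows "finite (X \<inter> int_span B)"
proof -
  have fB: "finite B" using assms(1) by (rule finiteI_independent)
  \<comment> \<open>Extending to a basis of the whole space makes each coordinate a bounded linear
    functional on all of it.\<close>
  obtain B' where B': "B \<subseteq> B'" "independent B'" "span B' = UNIV"
    using maximal_independent_subset_extend[OF subset_UNIV assms(1)]
    by (metis span_UNIV span_eq top.extremum_unique)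
  have "\<exists>K. \<forall>x\<in>X. \<bar>representation B' x b\<bar> \<le> K" for b
    using bounded_linear_image[OF assms(2) bounded_linear_representation[OF B'(2,3)], of b]
    by (auto simp: bounded_iff)
  then obtain K where K: "\<And>b x. x \<in> X \<Longrightarrow> \<bar>representation B' x b\<bar> \<le> K b" by metis
  let ?C = "PiE B (\<lambda>b. {- \<lceil>K b\<rceil>..\<lceil>K b\<rceil>})"
  have "X \<inter> int_span B \<subseteq> (\<lambda>c. \<Sum>b\<in>B. of_int (c b) *\<^sub>R b) ` ?C"
  proof
    fix x assume x: "x \<in> X \<inter> int_span B"
    then obtain c :: "real^'n \<Rightarrow> int" where c: "x = (\<Sum>b\<in>B. of_int (c b) *\<^sub>R b)"
      by (auto simp: int_span_def)
    have "c b \<in> {- \<lceil>K b\<rceil>..\<lceil>K b\<rceil>}" if "b \<in> B" for b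
    proof -
      have "representation B' x b = of_int (c b)"
        unfolding c using representation_sum_scaleR[OF B'(2,1) fB that] by simp
      then have "\<bar>of_int (c b)\<bar> \<le> K b" using K[of x b] x by simp
      then show ?thesis by (simp add: abs_le_iff) linarith
    qed
    then show "x \<in> (\<lambda>c. \<Sum>b\<in>B. of_int (c b) *\<^sub>R b) ` ?C"
      by (intro image_eqI[of _ _ "restrict c B"]) (auto simp: c)
  qed
  moreover have "finite ?C" using fB by (intro finite_PiE) auto
  ultimately show ?thesis by (meson finite_imageI finite_subset)
qed

lemma infnorm_less_iff_cart: "infnorm (x::real^'n) < r \<longleftrightarrow> (\<forall>i. \<bar>x $ i\<bar> < r)"
  by (auto simp: infnorm_Max Basis_vec_def inner_axis)

lemma infnorm_le_iff_cart: "infnorm (x::real^'n) \<le> r \<longleftrightarrow> (\<forall>i. \<bar>x $ i\<bar> \<le> r)"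
  by (auto simp: infnorm_Max Basis_vec_def inner_axis)

lemma bounded_sup_cube: "bounded (sup_cube T :: (real^'n) set)"
proof -
  have "sup_cube T \<subseteq> (cbox (\<chi> i. - T) (\<chi> i. T) :: (real^'n) set)"
    by (auto simp: sup_cube_def infnorm_le_iff_cart mem_box_cart abs_le_iff) (metis minus_le_iff)
  then show ?thesis using bounded_cbox bounded_subset by blast
qed

section \<open>Fundamental cells and volumes of packings\<close>

lemma fundamental_parallelepiped_lmeasurable:
  fixes B :: "(real^'n) set"
  assumes "independent B" "span B = UNIV"
  shows "fundamental_parallelepiped B \<in> lmeasurable"
    and "bounded (fundamental_parallelepiped B)"
proof -
  have fB: "finite B" using assms(1) by (rule finiteI_independent)
  have "fundamental_parallelepiped B = {x. \<forall>b\<in>B. 0 \<le> representation B x b \<and> representation B x b < 1}"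
  proof (intro equalityI subsetI; clarsimp)
    fix x b assume "x \<in> fundamental_parallelepiped B" "b \<in> B"
    then obtain c where c: "x = (\<Sum>b\<in>B. c b *\<^sub>R b)" "\<forall>b\<in>B. 0 \<le> c b \<and> c b < 1"
      by (auto simp: fundamental_parallelepiped_def)
    have "representation B x b = c b"
      unfolding c using representation_sum_scaleR[OF assms(1) order_refl fB \<open>b \<in> B\<close>] by simp
    then show "0 \<le> representation B x b \<and> representation B x b < 1"
      using c \<open>b \<in> B\<close> by simp
  next
    fix x assume *: "\<forall>b\<in>B. 0 \<le> representation B x b \<and> representation B x b < 1"
    have "x = (\<Sum>b\<in>B. representation B x b *\<^sub>R b)"
      using assms fB by (simp add: sum_representation_eq)
    with * show "x \<in> fundamental_parallelepiped B"
      by (auto simp: fundamental_parallelepiped_def)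
  qed
  also have "\<dots> = (\<Inter>b\<in>B. {x. 0 \<le> representation B x b} \<inter> {x. representation B x b < 1})"
    by auto
  also have "\<dots> \<in> sets borel"
  proof -
    have [measurable]: "(\<lambda>x. representation B x b) \<in> borel_measurable borel" for b
      using bounded_linear_representation[OF assms]
      by (intro borel_measurable_continuous_onI linear_continuous_on)
    show ?thesis using fB by (cases "B = {}") (auto intro!: sets.finite_INT)
  qed
  finally have 1: "fundamental_parallelepiped B \<in> sets lebesgue" by simp
  show 2: "bounded (fundamental_parallelepiped B)"
  proof (rule boundedI)
    fix x assume "x \<in> fundamental_parallelepiped B"
    then obtain c where c: "x = (\<Sum>b\<in>B. c b *\<^sub>R b)" "\<forall>b\<in>B. 0 \<le> c b \<and> c b < 1"
      by (auto simp: fundamental_parallelepiped_def)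
    have "norm x \<le> (\<Sum>b\<in>B. norm (c b *\<^sub>R b))" unfolding c by (rule norm_sum)
    also have "\<dots> \<le> (\<Sum>b\<in>B. norm b)"
      using c by (intro sum_mono) (auto intro!: mult_left_le_one_le simp: less_imp_le)
    finally show "norm x \<le> (\<Sum>b\<in>B. norm b)" .
  qed
  show "fundamental_parallelepiped B \<in> lmeasurable"
    using 1 2 by (rule bounded_set_imp_lmeasurable[rotated])
qed

lemma fundamental_parallelepiped_covers:
  fixes B :: "(real^'n) set"
  assumes "independent B" "span B = UNIV"
  shows "\<exists>v\<in>int_span B. x - v \<in> fundamental_parallelepiped B"
proof -
  have fB: "finite B" using assms(1) by (rule finiteI_independent)
  let ?r = "representation B x"
  have x: "x = (\<Sum>b\<in>B. ?r b *\<^sub>R b)"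
    using assms fB by (simp add: sum_representation_eq)
  let ?v = "\<Sum>b\<in>B. of_int \<lfloor>?r b\<rfloor> *\<^sub>R b"
  have "x - ?v = (\<Sum>b\<in>B. frac (?r b) *\<^sub>R b)"
    by (subst x) (simp add: frac_def scaleR_diff_left sum_subtractf)
  then have "x - ?v \<in> fundamental_parallelepiped B"
    by (auto simp: fundamental_parallelepiped_def frac_lt_1 intro!: exI[of _ "\<lambda>b. frac (?r b)"])
  moreover have "?v \<in> int_span B"
    unfolding int_span_def by (intro CollectI exI conjI) auto
  ultimately show ?thesis by blast
qed

text \<open>Blichfeldt's argument: \<open>S\<close> is cut into pieces lying in the translates
  \<open>v + F\<close>, and the pieces are moved back into \<open>F\<close>. The packing condition
  makes the moved pieces disjoint, so their total measure is at most that of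
  \<open>F\<close>.\<close>

lemma measure_le_if_packing_covered:
  fixes S F :: "'a::euclidean_space set"
  assumes S: "S \<in> lmeasurable" and F: "F \<in> lmeasurable" and "finite V"
    and cover: "S \<subseteq> (\<Union>v\<in>V. (+) v ` F)"
    and packing: "\<And>v w x y. v \<in> V \<Longrightarrow> w \<in> V \<Longrightarrow> x \<in> S \<Longrightarrow> y \<in> S \<Longrightarrow> x - v = y - w \<Longrightarrow> v = w"
  shows "measure lebesgue S \<le> measure lebesgue F"
proof -
  define G where "G v = (+) (- v) ` S \<inter> F" for v
  have G: "G v \<in> lmeasurable" for v
    unfolding G_def using S F by (intro fmeasurable.Int measurable_translation)
  have "S = (\<Union>v\<in>V. (+) v ` G v)"
  proof (intro equalityI subsetI)
    fix x assume x: "x \<in> S"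
    then obtain v f where v: "v \<in> V" "f \<in> F" "x = v + f" using cover by blast
    then have "f \<in> G v" using x by (auto simp: G_def image_iff intro!: bexI[of _ x])
    with v show "x \<in> (\<Union>v\<in>V. (+) v ` G v)" by blast
  qed (auto simp: G_def)
  then have "measure lebesgue S \<le> (\<Sum>v\<in>V. measure lebesgue ((+) v ` G v))"
    using measure_UNION_le[OF \<open>finite V\<close>, of "\<lambda>v. (+) v ` G v" lebesgue] measurable_translation[OF G]
    by (metis fmeasurableD)
  also have "\<dots> = (\<Sum>v\<in>V. measure lebesgue (G v))"
    by (simp add: measure_translation)
  also have "\<dots> = measure lebesgue (\<Union>v\<in>V. G v)"
  proof (rule measure_UNION'[symmetric])
    show "pairwise (\<lambda>i j. disjnt (G i) (G j)) V"
    proof (rule pairwiseI)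
      fix v w assume vw: "v \<in> V" "w \<in> V" "v \<noteq> w"
      show "disjnt (G v) (G w)"
      proof (rule ccontr)
        assume "\<not> disjnt (G v) (G w)"
        then obtain x y where "x \<in> S" "y \<in> S" "- v + x = - w + y"
          by (auto simp: disjnt_iff G_def)
        with packing[OF vw(1,2), of x y] vw(3) show False by simp
      qed
    qed
  qed (use G \<open>finite V\<close> in auto)
  also have "\<dots> \<le> measure lebesgue F"
  proof (rule measure_mono_fmeasurable[OF _ _ F])
    show "(\<Union>v\<in>V. G v) \<in> sets lebesgue" using G \<open>finite V\<close> by (intro sets.finite_UN) auto
  qed (auto simp: G_def)
  finally show ?thesis .
qed

text \<open>One copy of the fundamental cell for each representative in \<open>W\<close> gives a set
  \<open>F\<close> that meets every class modulo \<open>L\<close>. Its volume is at most the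
  right-hand side, and a set that packs by \<open>L\<close> cannot be larger than
  \<open>F\<close>.\<close>

lemma measure_packing_le:
  fixes B S L :: "(real^'n) set"
  assumes B: "independent B" "span B = UNIV"
    and L: "additive_subgroup L" "L \<subseteq> int_span B"
    and W: "finite W" "int_span B \<subseteq> (\<Union>w\<in>W. (+) w ` L)"
    and S: "S \<in> lmeasurable" "bounded S"
    and packing: "\<And>x y. x \<in> S \<Longrightarrow> y \<in> S \<Longrightarrow> x - y \<in> L \<Longrightarrow> x = y"
  shows "measure lebesgue S \<le> card W * measure lebesgue (fundamental_parallelepiped B)"
proof -
  note FB = fundamental_parallelepiped_lmeasurable[OF B]
  define F where "F = (\<Union>w\<in>W. (+) w ` fundamental_parallelepiped B)"
  have bF: "bounded F"
    unfolding F_def using W(1) FB(2) by (auto intro!: bounded_UN bounded_translation)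
  have F: "F \<in> lmeasurable"
    unfolding F_def using W(1) FB(1) by (auto intro!: fmeasurable.finite_UN measurable_translation)
  \<comment> \<open>These are the vectors of \<open>L\<close> that carry some point of
    \<open>F\<close> into \<open>S\<close>; as \<open>S\<close> and \<open>F\<close> are bounded,
    there are finitely many.\<close>
  define V where "V = (\<lambda>(x, f). x - f) ` (S \<times> F) \<inter> L"
  have "finite V"
  proof (rule finite_subset)
    show "V \<subseteq> (\<lambda>(x, f). x - f) ` (S \<times> F) \<inter> int_span B" using L(2) by (auto simp: V_def)
    show "finite \<dots>"
      using B(1) bounded_minus[OF S(2) bF] by (intro finite_bounded_int_span) auto
  qed
  have "measure lebesgue S \<le> measure lebesgue F"
  proof (rule measure_le_if_packing_covered[OF S(1) F \<open>finite V\<close>])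
    show "S \<subseteq> (\<Union>v\<in>V. (+) v ` F)"
    proof
      fix x assume x: "x \<in> S"
      obtain u where u: "u \<in> int_span B" "x - u \<in> fundamental_parallelepiped B"
        using fundamental_parallelepiped_covers[OF B] by blast
      then obtain w l where w: "w \<in> W" "l \<in> L" "u = w + l" using W(2) by blast
      then have "x - l = w + (x - u)" by simp
      then have xl: "x - l \<in> F" using u(2) w(1) unfolding F_def by blast
      then have "l \<in> V" using w(2) x by (force simp: V_def)
      with xl show "x \<in> (\<Union>v\<in>V. (+) v ` F)" by (auto intro!: bexI[of _ l] image_eqI[of _ _ "x - l"])
    qed
  next
    fix v w x y assume *: "v \<in> V" "w \<in> V" "x \<in> S" "y \<in> S" "x - v = y - w"
    then have "x - y = v - w" by (simp add: algebra_simps)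
    also have "\<dots> \<in> L" using * L(1) by (simp add: V_def additive_subgroup_def)
    finally show "v = w" using packing[of x y] * by simp
  qed
  also have "\<dots> \<le> (\<Sum>w\<in>W. measure lebesgue ((+) w ` fundamental_parallelepiped B))"
    unfolding F_def using W(1) FB(1)
    by (intro measure_UNION_le) (auto intro: fmeasurableD measurable_translation)
  also have "\<dots> = card W * measure lebesgue (fundamental_parallelepiped B)"
    by (simp add: measure_translation)
  finally show ?thesis .
qed

section \<open>Compression along a hyperplane\<close>

text \<open>The map fixes \<open>e\<close> and multiplies the hyperplane orthogonal to
  \<open>a\<close> by \<open>t\<close>. In a basis made of \<open>e\<close> and vectors of the
  hyperplane it is diagonal, with one entry 1 and all others \<open>t\<close>.\<close>

lemma det_dilation_of_hyperplane:
  fixes a e :: "real^'n" and t :: real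
  assumes "a \<bullet> e \<noteq> 0"
  shows "det (matrix (\<lambda>x. t *\<^sub>R x + ((1 - t) * (a \<bullet> x) / (a \<bullet> e)) *\<^sub>R e)) = t ^ (CARD('n) - 1)"
proof -
  have "a \<noteq> 0" using assms by auto
  then obtain j where j: "a $ j \<noteq> 0" by (auto simp: vec_eq_iff)
  define \<Phi> where "\<Phi> x = t *\<^sub>R x + ((1 - t) * (a \<bullet> x) / (a \<bullet> e)) *\<^sub>R e" for x
  \<comment> \<open>\<open>h\<close> keeps the coordinates other than \<open>j\<close> and solves
    \<open>a \<bullet> h x = 0\<close> for the remaining one. Thus \<open>A\<close> sends axis
    \<open>j\<close> to \<open>e\<close> and the other axes into the hyperplane, and conjugates
    \<open>\<Phi>\<close> to the diagonal map \<open>\<delta>\<close>.\<close>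
  define h where "h x = (\<chi> i. if i = j then - (\<Sum>k\<in>UNIV - {j}. a $ k * x $ k) / a $ j else x $ i)" for x :: "real^'n"
  define A where "A x = h x + (x $ j) *\<^sub>R e" for x
  define \<delta> where "\<delta> x = (\<chi> i. (if i = j then 1 else t) * x $ i)" for x :: "real^'n"
  have "linear \<Phi>"
    by (rule linearI) (simp_all add: \<Phi>_def algebra_simps add_divide_distrib diff_divide_distrib)
  have "linear h"
    by (rule linearI)
       (simp_all add: h_def vec_eq_iff algebra_simps sum.distrib add_divide_distrib diff_divide_distrib sum_distrib_left)
  then have "linear A"
    by (intro linearI) (simp_all add: A_def linear_add linear_scale algebra_simps)
  have "linear \<delta>"
    by (rule linearI) (simp_all add: \<delta>_def vec_eq_iff algebra_simps)
  have ah: "a \<bullet> h x = 0" for x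
    using j by (simp add: inner_vec_def h_def sum.remove[of UNIV j] if_distrib cong: if_cong)
  have "inj A"
    unfolding linear_injective_0[OF \<open>linear A\<close>]
  proof (intro allI impI)
    fix x assume "A x = 0"
    then have "a \<bullet> A x = 0" by simp
    then have xj: "x $ j = 0" using assms by (simp add: A_def inner_add_right ah)
    then have "h x = 0" using \<open>A x = 0\<close> by (simp add: A_def)
    then have "x $ i = 0" if "i \<noteq> j" for i using that by (auto simp: h_def vec_eq_iff dest: spec[of _ i])
    with xj show "x = 0" by (metis vec_eq_iff zero_index)
  qed
  then have detA: "det (matrix A) \<noteq> 0"
    using det_nz_iff_inj[OF \<open>linear A\<close>] by simp
  have "\<Phi> (A x) = A (\<delta> x)" for x
  proof -
    have "h (\<delta> x) = t *\<^sub>R h x"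
      by (simp add: h_def \<delta>_def vec_eq_iff sum_distrib_left mult.left_commute)
    then show ?thesis
      using assms by (simp add: \<Phi>_def A_def inner_add_right ah \<delta>_def algebra_simps diff_divide_distrib)
  qed
  then have "\<Phi> \<circ> A = A \<circ> \<delta>" by auto
  then have "matrix \<Phi> ** matrix A = matrix A ** matrix \<delta>"
    using \<open>linear \<Phi>\<close> \<open>linear A\<close> \<open>linear \<delta>\<close> by (metis matrix_compose)
  then have "det (matrix \<Phi>) * det (matrix A) = det (matrix A) * det (matrix \<delta>)"
    by (metis det_mul)
  then have "det (matrix \<Phi>) = det (matrix \<delta>)" using detA by simp
  also have "\<dots> = (\<Prod>i\<in>UNIV. if i = j then 1 else t)"
    by (subst det_diagonal) (auto simp: matrix_def \<delta>_def axis_def intro!: prod.cong)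
  also have "\<dots> = t ^ (CARD('n) - 1)"
    by (simp add: prod.remove[of UNIV j] card_Diff_singleton)
  finally show ?thesis by (simp add: \<Phi>_def[abs_def])
qed

lemma prod_inner_Basis_cart: "(\<Prod>b\<in>Basis. x \<bullet> b) = (\<Prod>i\<in>UNIV. (x :: real^'n) $ i)"
  by (simp add: Basis_vec_def UNION_singleton_eq_range prod.reindex axis_eq_axis inj_on_def inner_axis)

text \<open>\<open>measure_linear_image\<close> requires a well-ordered index type, hence the detour through a
  well-ordered copy.\<close>

typedef 'a wo_copy = "UNIV :: 'a set" morphisms of_wo to_wo ..

instance wo_copy :: (finite) finite
proof
  have "(UNIV :: 'a wo_copy set) = range to_wo" by (metis of_wo_inverse surjI)
  then show "finite (UNIV :: 'a wo_copy set)" by (metis finite finite_imageI)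
qed

text \<open>An arbitrary injection suffices: it pulls the well-order of the natural numbers back to
  the copy.\<close>

definition wo_index :: "'a::finite wo_copy \<Rightarrow> nat" where
  "wo_index = (SOME f. inj f)"

lemma inj_wo_index: "inj wo_index"
proof -
  have "\<exists>f :: 'a wo_copy \<Rightarrow> nat. inj f" using finite_imp_inj_to_nat_seg[OF finite[of UNIV]] by auto
  then show ?thesis unfolding wo_index_def by (rule someI_ex)
qed

instantiation wo_copy :: (finite) wellorder
begin

definition "x \<le> y \<longleftrightarrow> wo_index x \<le> wo_index y" for x y :: "'a wo_copy"
definition "x < y \<longleftrightarrow> wo_index x < wo_index y" for x y :: "'a wo_copy"

instance
proof
  fix x y z :: "'a wo_copy"
  show "x < y \<longleftrightarrow> x \<le> y \<and> \<not> y \<le> x" "x \<le> x" "x \<le> y \<or> y \<le> x"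
    and "x \<le> y \<Longrightarrow> y \<le> z \<Longrightarrow> x \<le> z"
    by (auto simp: less_eq_wo_copy_def less_wo_copy_def)
  show "x = y" if "x \<le> y" "y \<le> x"
    using that by (intro injD[OF inj_wo_index]) (simp add: less_eq_wo_copy_def)
next
  fix P :: "'a wo_copy \<Rightarrow> bool" and x
  assume step: "\<And>x. (\<And>y. y < x \<Longrightarrow> P y) \<Longrightarrow> P x"
  show "P x"
  proof (induction "wo_index x" arbitrary: x rule: less_induct)
    case less
    show ?case by (rule step, rule less) (simp add: less_wo_copy_def)
  qed
qed

end

section \<open>Transport of Lebesgue measure along reindexing\<close>

definition to_wo_vec :: "real^'n \<Rightarrow> real^'n wo_copy" where
  "to_wo_vec x = (\<chi> i. x $ of_wo i)"

lemma bij_of_wo: "bij of_wo"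
  by (metis bijI' of_wo_inject to_wo_inverse UNIV_I)

lemma linear_to_wo_vec: "linear to_wo_vec"
  by (rule linearI) (simp_all add: to_wo_vec_def vec_eq_iff)

lemma bij_to_wo_vec: "bij (to_wo_vec :: real^'n \<Rightarrow> _)"
proof (rule bijI')
  show "to_wo_vec x = to_wo_vec y \<longleftrightarrow> x = y" for x y :: "real^'n"
    by (simp add: to_wo_vec_def vec_eq_iff) (metis to_wo_inverse UNIV_I)
  show "\<exists>x. y = to_wo_vec x" for y :: "real^('n::finite) wo_copy"
    by (rule exI[of _ "\<chi> i. y $ to_wo i"]) (simp add: to_wo_vec_def vec_eq_iff of_wo_inverse)
qed

lemma inner_to_wo_vec: "to_wo_vec x \<bullet> to_wo_vec y = x \<bullet> y"
  unfolding inner_vec_def to_wo_vec_def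
  by (simp add: sum.reindex_bij_betw[OF bij_of_wo, of "\<lambda>i. x $ i * y $ i"])

text \<open>Lebesgue measure is determined by its values on boxes, and reindexing only permutes the
  side lengths.\<close>

lemma lborel_to_wo_vec: "lborel = distr lborel borel (to_wo_vec :: real^'n \<Rightarrow> _)"
proof (rule lborel_eqI)
  have [measurable]: "to_wo_vec \<in> borel_measurable (borel :: (real^'n) measure)"
    using linear_to_wo_vec by (intro borel_measurable_continuous_onI linear_continuous_on)
      (simp add: linear_conv_bounded_linear)
  fix l u :: "real^('n::finite) wo_copy" assume lu: "\<And>b. b \<in> Basis \<Longrightarrow> l \<bullet> b \<le> u \<bullet> b"
  obtain l' u' where l': "l = to_wo_vec l'" "u = to_wo_vec u'"
    using bij_to_wo_vec by (metis bij_pointE)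
  have le: "l' $ i \<le> u' $ i" for i
    using lu[of "axis (to_wo i) 1"] by (simp add: l' to_wo_vec_def inner_axis to_wo_inverse)
  have "to_wo_vec -` box l u = box l' u'"
  proof -
    have "(\<forall>i. l' $ of_wo i < x $ of_wo i \<and> x $ of_wo i < u' $ of_wo i) \<longleftrightarrow>
      (\<forall>i. l' $ i < x $ i \<and> x $ i < u' $ i)" for x
      by (metis to_wo_inverse UNIV_I)
    then show ?thesis by (auto simp: mem_box_cart l' to_wo_vec_def)
  qed
  then have "emeasure (distr lborel borel to_wo_vec) (box l u) = emeasure lborel (box l' u')"
    by (simp add: emeasure_distr)
  also have "\<dots> = (\<Prod>b\<in>Basis. (u' - l') \<bullet> b)"
    using le by (intro emeasure_lborel_box) (auto simp: Basis_vec_def inner_axis)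
  also have "(\<Prod>b\<in>Basis. (u' - l') \<bullet> b) = (\<Prod>i\<in>UNIV. (u' - l') $ i)"
    by (simp add: prod_inner_Basis_cart)
  also have "\<dots> = (\<Prod>i\<in>UNIV. (u - l) $ i)"
    by (simp add: l' to_wo_vec_def prod.reindex_bij_betw[OF bij_of_wo, of "\<lambda>i. u' $ i - l' $ i"])
  also have "\<dots> = (\<Prod>b\<in>Basis. (u - l) \<bullet> b)"
    by (simp add: prod_inner_Basis_cart)
  finally show "emeasure (distr lborel borel to_wo_vec) (box l u) = (\<Prod>b\<in>Basis. (u - l) \<bullet> b)" .
qed simp

text \<open>For open sets both the set and its image are Borel, where \<open>lebesgue\<close> and
  \<open>lborel\<close> agree.\<close>

lemma measure_to_wo_vec_image:
  fixes S :: "(real^'n) set"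
  assumes "open S"
  shows "open (to_wo_vec ` S)" and "measure lebesgue (to_wo_vec ` S) = measure lebesgue S"
proof -
  have inj: "inj (to_wo_vec :: real^'n \<Rightarrow> _)" using bij_to_wo_vec by (rule bij_is_inj)
  show op: "open (to_wo_vec ` S)"
    using assms linear_to_wo_vec bij_is_surj[OF bij_to_wo_vec] by (rule open_surjective_linear_image)
  have [measurable]: "to_wo_vec \<in> borel_measurable (borel :: (real^'n) measure)"
    using linear_to_wo_vec by (intro borel_measurable_continuous_onI linear_continuous_on)
      (simp add: linear_conv_bounded_linear)
  have "measure lebesgue (to_wo_vec ` S) = measure lborel (to_wo_vec ` S)"
    using op by (simp add: measure_completion)
  also have "\<dots> = measure (distr lborel borel (to_wo_vec :: real^'n \<Rightarrow> _)) (to_wo_vec ` S)"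
    by (simp flip: lborel_to_wo_vec)
  also have "\<dots> = measure lborel (to_wo_vec -` to_wo_vec ` S)"
    using op by (simp add: measure_distr)
  also have "\<dots> = measure lebesgue S"
    using assms by (simp add: inj_vimage_image_eq[OF inj] measure_completion)
  finally show "measure lebesgue (to_wo_vec ` S) = measure lebesgue S" .
qed

lemma measure_dilation_of_hyperplane:
  fixes a e :: "real^'n" and t :: real
  assumes "a \<bullet> e \<noteq> 0" "t > 0" "open S" "bounded S"
  defines "\<Phi> \<equiv> \<lambda>x. t *\<^sub>R x + ((1 - t) * (a \<bullet> x) / (a \<bullet> e)) *\<^sub>R e"
  shows "open (\<Phi> ` S)" and "measure lebesgue (\<Phi> ` S) = t ^ (CARD('n) - 1) * measure lebesgue S"
proof -
  have lin: "linear \<Phi>"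
    unfolding \<Phi>_def
    by (rule linearI) (simp_all add: algebra_simps add_divide_distrib diff_divide_distrib)
  have "inj \<Phi>"
    using det_dilation_of_hyperplane[OF assms(1), of t] \<open>t > 0\<close> det_nz_iff_inj[OF lin]
    by (simp add: \<Phi>_def)
  then have "surj \<Phi>" using lin by (simp add: linear_injective_imp_surjective)
  then show op: "open (\<Phi> ` S)" using assms(3) lin by (intro open_surjective_linear_image)
  let ?g = "to_wo_vec :: real^'n \<Rightarrow> _"
  define \<Psi> where "\<Psi> x = t *\<^sub>R x + ((1 - t) * (?g a \<bullet> x) / (?g a \<bullet> ?g e)) *\<^sub>R ?g e" for x
  have lin': "linear \<Psi>"
    unfolding \<Psi>_def
    by (rule linearI) (simp_all add: algebra_simps add_divide_distrib diff_divide_distrib)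
  \<comment> \<open>Reindexing preserves inner products, so it turns \<open>\<Phi>\<close> into a
    map of the same form over the well-ordered index type.\<close>
  have "?g (\<Phi> x) = \<Psi> (?g x)" for x
    unfolding \<Phi>_def \<Psi>_def inner_to_wo_vec
    by (simp add: linear_add[OF linear_to_wo_vec] linear_scale[OF linear_to_wo_vec])
  then have img: "?g ` \<Phi> ` S = \<Psi> ` ?g ` S" by (auto simp: image_image)
  have "bounded (?g ` S)"
    using assms(4) linear_to_wo_vec by (intro bounded_linear_image) (simp_all add: linear_conv_bounded_linear)
  then have gS: "?g ` S \<in> lmeasurable"
    using measure_to_wo_vec_image(1)[OF assms(3)] by (simp add: lmeasurable_open)
  have "measure lebesgue (\<Phi> ` S) = measure lebesgue (\<Psi> ` ?g ` S)"
    using measure_to_wo_vec_image(2)[OF op] by (simp add: img)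
  also have "\<dots> = \<bar>det (matrix \<Psi>)\<bar> * measure lebesgue (?g ` S)"
    by (rule measure_linear_image[OF lin' gS])
  also have "det (matrix \<Psi>) = t ^ (CARD('n wo_copy) - 1)"
    unfolding \<Psi>_def by (rule det_dilation_of_hyperplane) (simp add: inner_to_wo_vec assms(1))
  also have "CARD('n wo_copy) = CARD('n)"
    using bij_of_wo by (rule bij_betw_same_card)
  finally show "measure lebesgue (\<Phi> ` S) = t ^ (CARD('n) - 1) * measure lebesgue S"
    using \<open>t > 0\<close> measure_to_wo_vec_image(2)[OF assms(3)] by simp
qed

text \<open>A weak form of Minkowski's second theorem. Compressing the cube of side \<open>\<mu>\<close> by the factor
  \<open>\<kappa> / \<mu>\<close> along a hyperplane that contains all lattice vectors shorter than \<open>\<mu>\<close> gives a set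
  whose translates by \<open>L\<close> are disjoint. The complementary direction \<open>e\<close> is a vertex of the cube
  at which the linear form \<open>a\<close> is maximal, so the compression maps the cube into itself.\<close>

lemma first_last_minimum_le:
  fixes L :: "(real^'n) set" and a :: "real^'n"
  assumes "0 < \<kappa>" "\<kappa> \<le> \<mu>" "a \<noteq> 0"
    and first: "\<And>v. v \<in> L \<Longrightarrow> v \<noteq> 0 \<Longrightarrow> \<kappa> \<le> infnorm v"
    and last: "\<And>v. v \<in> L \<Longrightarrow> infnorm v < \<mu> \<Longrightarrow> a \<bullet> v = 0"
    and packing: "\<And>S. S \<in> lmeasurable \<Longrightarrow> bounded S \<Longrightarrow>
       (\<And>x y. x \<in> S \<Longrightarrow> y \<in> S \<Longrightarrow> x - y \<in> L \<Longrightarrow> x = y) \<Longrightarrow> measure lebesgue S \<le> C"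
  shows "\<mu> * \<kappa> ^ (CARD('n) - 1) \<le> C"
proof -
  \<comment> \<open>With this sign vector \<open>a \<bullet> e\<close> is the sum of the absolute
    values of the entries of \<open>a\<close>, the dual norm to the sup-norm.\<close>
  define e :: "real^'n" where "e = (\<chi> i. if a $ i \<ge> 0 then 1 else - 1)"
  define N where "N = a \<bullet> e"
  have N: "N = (\<Sum>i\<in>UNIV. \<bar>a $ i\<bar>)"
    unfolding N_def inner_vec_def e_def by (intro sum.cong) auto
  obtain j where "a $ j \<noteq> 0" using \<open>a \<noteq> 0\<close> by (auto simp: vec_eq_iff)
  then have "N > 0" unfolding N by (intro sum_pos2[of _ j]) auto
  define t where "t = \<kappa> / \<mu>"
  have t: "0 < t" "t \<le> 1" "t * \<mu> = \<kappa>" using assms(1,2) by (auto simp: t_def)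
  define \<Phi> where "\<Phi> x = t *\<^sub>R x + ((1 - t) * (a \<bullet> x) / N) *\<^sub>R e" for x
  have lin: "linear \<Phi>"
    by (rule linearI) (simp_all add: \<Phi>_def algebra_simps add_divide_distrib diff_divide_distrib)
  have e: "infnorm e \<le> 1" by (simp add: infnorm_le_iff_cart e_def)
  have ax: "\<bar>a \<bullet> x\<bar> \<le> N * infnorm x" for x
  proof -
    have "\<bar>a \<bullet> x\<bar> \<le> (\<Sum>i\<in>UNIV. \<bar>a $ i * x $ i\<bar>)"
      unfolding inner_vec_def by (simp add: sum_abs)
    also have "\<dots> \<le> (\<Sum>i\<in>UNIV. \<bar>a $ i\<bar> * infnorm x)"
      by (intro sum_mono) (simp add: abs_mult mult_left_mono component_le_infnorm_cart)
    finally show ?thesis by (simp add: N sum_distrib_right)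
  qed
  \<comment> \<open>\<open>\<Phi> x\<close> is a convex combination, with weights \<open>t\<close>
    and \<open>1 - t\<close>, of \<open>x\<close> and
    \<open>((a \<bullet> x) / N) *\<^sub>R e\<close>; by duality neither exceeds
    \<open>infnorm x\<close>.\<close>
  have \<Phi>_le: "infnorm (\<Phi> x) \<le> infnorm x" for x
  proof -
    have "infnorm (\<Phi> x) \<le> infnorm (t *\<^sub>R x) + infnorm (((1 - t) * (a \<bullet> x) / N) *\<^sub>R e)"
      unfolding \<Phi>_def by (rule infnorm_triangle)
    also have "\<dots> = t * infnorm x + (1 - t) * (\<bar>a \<bullet> x\<bar> / N) * infnorm e"
      using t \<open>N > 0\<close> by (simp add: infnorm_mul abs_mult)
    also have "\<dots> \<le> t * infnorm x + (1 - t) * infnorm x * 1"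
    proof -
      have "\<bar>a \<bullet> x\<bar> / N \<le> infnorm x" using ax[of x] \<open>N > 0\<close> by (simp add: field_simps)
      then show ?thesis
        using t(1,2) \<open>N > 0\<close> e
        by (intro add_mono mult_mono mult_left_mono mult_nonneg_nonneg) (auto simp: infnorm_pos_le)
    qed
    finally show ?thesis by (simp add: algebra_simps)
  qed
  have a\<Phi>: "a \<bullet> \<Phi> x = a \<bullet> x" for x
  proof -
    have "a \<bullet> \<Phi> x = t * (a \<bullet> x) + (1 - t) * (a \<bullet> x) / N * N"
      by (simp add: \<Phi>_def inner_add_right N_def)
    then show ?thesis using \<open>N > 0\<close> by (simp add: algebra_simps diff_divide_distrib)
  qed
  \<comment> \<open>The cube is open so that differences of its points have norm strictly below
    \<mu>, as \<open>last\<close> demands.\<close>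
  define K :: "(real^'n) set" where "K = box (\<chi> i. - \<mu> / 2) (\<chi> i. \<mu> / 2)"
  have K: "open K" "bounded K" by (auto simp: K_def open_box)
  have \<Phi>K: "open (\<Phi> ` K)" "measure lebesgue (\<Phi> ` K) = t ^ (CARD('n) - 1) * measure lebesgue K"
    using measure_dilation_of_hyperplane[of a e t, OF _ _ K] \<open>N > 0\<close> t(1)
    by (simp_all add: \<Phi>_def[abs_def] N_def)
  have "bounded (\<Phi> ` K)"
    using K(2) lin by (intro bounded_linear_image) (simp_all add: linear_conv_bounded_linear)
  have "measure lebesgue (\<Phi> ` K) \<le> C"
  proof (rule packing)
    show "bounded (\<Phi> ` K)" by fact
    show "\<Phi> ` K \<in> lmeasurable" using \<Phi>K(1) \<open>bounded (\<Phi> ` K)\<close> by (simp add: lmeasurable_open)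
    fix x' y' assume "x' \<in> \<Phi> ` K" "y' \<in> \<Phi> ` K" and L: "x' - y' \<in> L"
    then obtain x y where xy: "x \<in> K" "y \<in> K" "x' = \<Phi> x" "y' = \<Phi> y" by auto
    define w where "w = x - y"
    have w: "x' - y' = \<Phi> w" using xy lin by (simp add: w_def linear_diff)
    have "\<bar>w $ i\<bar> < \<mu>" for i
    proof -
      have "- \<mu> / 2 < x $ i" "x $ i < \<mu> / 2" "- \<mu> / 2 < y $ i" "y $ i < \<mu> / 2"
        using xy by (auto simp: K_def mem_box_cart)
      then show ?thesis unfolding w_def vector_minus_component by linarith
    qed
    then have "infnorm w < \<mu>" by (simp add: infnorm_less_iff_cart)
    \<comment> \<open>The lattice vector \<open>\<Phi> w\<close> is shorter than \<mu>, so it lies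
      in the hyperplane. As \<open>\<Phi>\<close> preserves \<open>a\<close>, so does
      \<open>w\<close>, where \<open>\<Phi>\<close> is scaling by \<open>t\<close>; the norm thus
      drops below \<open>t * \<mu> = \<kappa>\<close>, which forces zero.\<close>
    then have "a \<bullet> \<Phi> w = 0" using \<Phi>_le[of w] L w by (intro last) auto
    then have \<Phi>w: "\<Phi> w = t *\<^sub>R w" by (simp add: a\<Phi>) (simp add: \<Phi>_def)
    have "infnorm (\<Phi> w) < \<kappa>"
      using \<open>infnorm w < \<mu>\<close> t by (simp add: \<Phi>w infnorm_mul flip: t(3))
    then have "\<Phi> w = 0" using first[of "\<Phi> w"] L w by auto
    then show "x' = y'" using w by simp
  qed
  moreover note \<Phi>K(2)
  moreover have "measure lebesgue K = \<mu> ^ CARD('n)"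
  proof -
    have "measure lebesgue K = (\<Prod>b\<in>Basis. ((\<chi> i. \<mu> / 2) - (\<chi> i. - \<mu> / 2) :: real^'n) \<bullet> b)"
      unfolding K_def using assms(1,2)
      by (simp add: measure_lborel_box_eq Basis_vec_def inner_axis measure_completion)
    then show ?thesis by (simp add: prod_inner_Basis_cart)
  qed
  moreover have "\<mu> * \<kappa> ^ (CARD('n) - 1) = t ^ (CARD('n) - 1) * \<mu> ^ CARD('n)"
  proof -
    have "CARD('n) = Suc (CARD('n) - 1)" by simp
    then have "\<mu> ^ CARD('n) = \<mu> * \<mu> ^ (CARD('n) - 1)" by (metis power_Suc)
    then show ?thesis by (simp add: power_mult_distrib flip: t(3))
  qed
  ultimately show ?thesis by simp
qed

section \<open>The bound\<close>

text \<open>\<open>LEAST\<close> on the reals needs an attained minimum. It is found among the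
  finitely many norms of nonzero vectors of \<open>L\<close> not longer than
  \<open>w\<close>.\<close>

lemma successive_minimum_1:
  fixes L :: "(real^'n) set"
  assumes fin: "\<And>T. finite (sup_cube T \<inter> L)" and "w \<in> L" "w \<noteq> 0"
  shows "0 < successive_minimum 1 L"
    and "\<And>v. v \<in> L \<Longrightarrow> v \<noteq> 0 \<Longrightarrow> successive_minimum 1 L \<le> infnorm v"
proof -
  define N where "N = infnorm ` (sup_cube (infnorm w) \<inter> L - {0})"
  have N: "finite N" "N \<noteq> {}"
    using fin assms(2,3) by (auto simp: N_def sup_cube_def)
  have "Min N \<in> N" using N by (rule Min_in)
  then obtain u where u: "u \<in> L" "u \<noteq> 0" "Min N = infnorm u" by (auto simp: N_def)
  have pos: "0 < Min N" using u by (simp add: infnorm_pos_lt)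
  have le: "Min N \<le> infnorm v" if "v \<in> L" "v \<noteq> 0" for v
  proof (cases "infnorm v \<le> infnorm w")
    case True
    then show ?thesis using that N by (intro Min_le) (auto simp: N_def sup_cube_def)
  next
    case False
    have "Min N \<le> infnorm w" using assms N by (intro Min_le) (auto simp: N_def sup_cube_def)
    with False show ?thesis by simp
  qed
  have dim: "dim (span (sup_cube T \<inter> L)) \<ge> 1 \<longleftrightarrow> (\<exists>v\<in>L. v \<noteq> 0 \<and> infnorm v \<le> T)" for T
  proof -
    have "dim (span (sup_cube T \<inter> L)) \<ge> 1 \<longleftrightarrow> \<not> sup_cube T \<inter> L \<subseteq> {0}"
      by (metis dim_eq_0 dim_span less_one not_less)
    then show ?thesis by (auto simp: sup_cube_def)
  qed
  have "successive_minimum 1 L = Min N"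
    unfolding successive_minimum_def dim
    by (rule Least_equality) (use pos u le in force)+
  then show "0 < successive_minimum 1 L"
    and "\<And>v. v \<in> L \<Longrightarrow> v \<noteq> 0 \<Longrightarrow> successive_minimum 1 L \<le> infnorm v"
    using pos le by auto
qed

text \<open>\<mu> is the least norm whose cube contains a spanning set of vectors of
  \<open>L\<close>. The strictly shorter vectors then fail to span, and \<open>a\<close> is the
  normal of a hyperplane containing them.\<close>

lemma last_minimum_exists:
  fixes L :: "(real^'n) set"
  assumes fin: "\<And>T. finite (sup_cube T \<inter> L)" and "span L = UNIV"
  obtains \<mu> a where "span (sup_cube \<mu> \<inter> L) = UNIV" "a \<noteq> 0"
    "\<And>v. v \<in> L \<Longrightarrow> infnorm v < \<mu> \<Longrightarrow> a \<bullet> v = 0"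
proof -
  have ne: "G \<noteq> {}" if "span G = UNIV" for G :: "(real^'n) set"
  proof
    assume "G = {}"
    with that have "(UNIV :: (real^'n) set) = {0}" by simp
    moreover have "(\<chi> i. 1) \<noteq> (0 :: real^'n)" by (simp add: vec_eq_iff)
    ultimately show False by blast
  qed
  obtain B where B: "B \<subseteq> L" "independent B" "L \<subseteq> span B"
    using maximal_independent_subset by blast
  have fB: "finite B" using B(2) by (rule finiteI_independent)
  have sB: "span B = UNIV"
    using span_mono[OF B(3)] assms(2) by (auto simp: span_span)
  define T where "T = Max (infnorm ` B)"
  have BT: "B \<subseteq> sup_cube T \<inter> L"
    using B(1) fB by (auto simp: T_def sup_cube_def)
  define R where "R = {r \<in> infnorm ` (sup_cube T \<inter> L). span (sup_cube r \<inter> L) = UNIV}"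
  have "finite R" using fin by (simp add: R_def)
  have "T \<in> infnorm ` B" unfolding T_def using fB ne[OF sB] by (intro Max_in) auto
  moreover have "span (sup_cube T \<inter> L) = UNIV" using span_mono[OF BT] sB by auto
  ultimately have "T \<in> R" using BT by (auto simp: R_def)
  define \<mu> where "\<mu> = Min R"
  have \<mu>: "\<mu> \<in> R" "\<mu> \<le> T" using \<open>finite R\<close> \<open>T \<in> R\<close> by (auto simp: \<mu>_def intro!: Min_in)
  define G where "G = {v \<in> L. infnorm v < \<mu>}"
  have GT: "G \<subseteq> sup_cube T \<inter> L" using \<mu>(2) by (auto simp: G_def sup_cube_def)
  \<comment> \<open>Otherwise the largest norm in the finite set \<open>G\<close> would be a
    candidate in \<open>R\<close> below its minimum \<mu>.\<close>
  have "span G \<noteq> UNIV"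
  proof
    assume G: "span G = UNIV"
    define r where "r = Max (infnorm ` G)"
    have fG: "finite G" using finite_subset[OF GT fin] .
    have rG: "r \<in> infnorm ` G" unfolding r_def using fG ne[OF G] by (intro Max_in) auto
    have "G \<subseteq> sup_cube r \<inter> L" using fG by (auto simp: r_def G_def sup_cube_def)
    then have "span (sup_cube r \<inter> L) = UNIV" using span_mono G by blast
    then have "r \<in> R" using rG GT by (auto simp: R_def)
    then have "\<mu> \<le> r" unfolding \<mu>_def using \<open>finite R\<close> by (rule Min_le[rotated])
    moreover have "r < \<mu>" using rG by (auto simp: G_def)
    ultimately show False by simp
  qed
  then obtain a where a: "a \<noteq> 0" "span G \<subseteq> {x. a \<bullet> x = 0}"
    using span_not_univ_subset_hyperplane by blast
  show thesis
  proof (rule that)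
    show "span (sup_cube \<mu> \<inter> L) = UNIV" using \<mu>(1) by (simp add: R_def)
    fix v assume "v \<in> L" "infnorm v < \<mu>"
    then have "v \<in> span G" by (intro span_base) (simp add: G_def)
    then show "a \<bullet> v = 0" using a(2) by blast
  qed fact
qed

text \<open>Each point is sent to its tuple of cosets. Points with equal tuples differ by an element
  of the intersection, so one representative per attained tuple suffices.\<close>

lemma common_coset_representatives:
  fixes M :: "'i \<Rightarrow> (real^'n) set"
  assumes "finite I" and M: "\<And>i. i \<in> I \<Longrightarrow> additive_subgroup (M i)"
    and fin: "\<And>i. i \<in> I \<Longrightarrow> finite (lattice_cosets L (M i))"
  obtains W where "finite W" "card W \<le> (\<Prod>i\<in>I. card (lattice_cosets L (M i)))"
    "L \<subseteq> (\<Union>w\<in>W. (+) w ` (\<Inter>i\<in>I. M i))"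
proof -
  define g where "g x = restrict (\<lambda>i. (+) x ` M i) I" for x
  have sub: "g ` L \<subseteq> PiE I (\<lambda>i. lattice_cosets L (M i))"
    by (auto simp: g_def lattice_cosets_def)
  have finP: "finite (PiE I (\<lambda>i. lattice_cosets L (M i)))"
    using assms by (intro finite_PiE) auto
  define W where "W = inv_into L g ` g ` L"
  have fgL: "finite (g ` L)" using finite_subset[OF sub finP] .
  have "card W \<le> card (g ` L)"
    unfolding W_def using fgL by (rule card_image_le)
  also have "\<dots> \<le> (\<Prod>i\<in>I. card (lattice_cosets L (M i)))"
    using card_mono[OF finP sub] by (simp add: card_PiE \<open>finite I\<close>)
  finally have "card W \<le> \<dots>" .
  moreover have "L \<subseteq> (\<Union>w\<in>W. (+) w ` (\<Inter>i\<in>I. M i))"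
  proof
    fix x assume x: "x \<in> L"
    define w where "w = inv_into L g (g x)"
    have "w \<in> W" using x by (simp add: w_def W_def)
    have gw: "g w = g x" using x by (simp add: w_def f_inv_into_f)
    have "x - w \<in> M i" if "i \<in> I" for i
    proof -
      have "(+) w ` M i = (+) x ` M i" using fun_cong[OF gw, of i] that by (simp add: g_def)
      moreover have "x \<in> (+) x ` M i"
        using M[OF that] by (force simp: additive_subgroup_def)
      ultimately have "x \<in> (+) w ` M i" by simp
      then show ?thesis by auto
    qed
    then have "x \<in> (+) w ` (\<Inter>i\<in>I. M i)"
      by (intro image_eqI[of _ _ "x - w"]) auto
    with \<open>w \<in> W\<close> show "x \<in> (\<Union>w\<in>W. (+) w ` (\<Inter>i\<in>I. M i))" by blast
  qed
  moreover have "finite W" using fgL by (simp add: W_def)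
  ultimately show thesis using that by blast
qed

text \<open>By pigeonhole two distinct multiples of \<open>x\<close> share a representative in
  \<open>W\<close>; their difference is a nonzero multiple of \<open>x\<close> in
  \<open>M\<close>.\<close>

lemma finite_index_subset_span:
  fixes L M :: "'a::real_vector set"
  assumes L: "additive_subgroup L" and M: "additive_subgroup M"
    and "finite W" "L \<subseteq> (\<Union>w\<in>W. (+) w ` M)"
  shows "L \<subseteq> span M"
proof
  fix x assume x: "x \<in> L"
  have "\<exists>w\<in>W. real n *\<^sub>R x - w \<in> M" for n
  proof -
    have "real n *\<^sub>R x \<in> L" using additive_subgroup_of_int_scaleR[OF L x, of "int n"] by simp
    then obtain w v where "w \<in> W" "v \<in> M" "real n *\<^sub>R x = w + v" using assms(4) by blast
    then show ?thesis by (intro bexI[of _ w]) auto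
  qed
  then obtain w where w: "\<And>n. w n \<in> W" "\<And>n. real n *\<^sub>R x - w n \<in> M" by metis
  have "\<not> inj w"
    using w(1) \<open>finite W\<close> by (metis finite_subset image_subsetI infinite_UNIV_nat finite_imageD)
  then obtain n k where nk: "n \<noteq> k" "w n = w k" by (auto simp: inj_def)
  have "(real n *\<^sub>R x - w n) - (real k *\<^sub>R x - w k) \<in> M"
    using M w(2) unfolding additive_subgroup_def by blast
  then have "(real n - real k) *\<^sub>R x \<in> M" using nk by (simp add: algebra_simps)
  then have "inverse (real n - real k) *\<^sub>R ((real n - real k) *\<^sub>R x) \<in> span M"
    by (intro span_scale span_base)
  then show "x \<in> span M" using nk by simp
qed

lemma nonzero_point_in_translated_lattice:
  fixes B :: "(real^'n) set" and P :: "'n real_mpoly"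
  assumes B: "independent B" "span B = UNIV" and \<mu>: "\<And>b. b \<in> B \<Longrightarrow> infnorm b \<le> \<mu>"
    and "P \<noteq> 0"
  obtains z where "z - y \<in> int_span B" "mpoly_eval P z \<noteq> 0"
    "infnorm z \<le> real CARD('n) * ((real (mpoly_degree P) + 1) / 2 * \<mu>)"
proof -
  define m where "m = mpoly_degree P"
  have fB: "finite B" using B(1) by (rule finiteI_independent)
  have cB: "card B = CARD('n)"
    using dim_eq_card[of B UNIV] B by (simp add: dim_UNIV)
  have rep: "x = (\<Sum>b\<in>B. representation B x b *\<^sub>R b)" for x
    using B fB by (simp add: sum_representation_eq)
  define r where "r = representation B y"
  \<comment> \<open>\<open>r b + k b\<close> falls in the first unit step of the interval from
    \<open>-(m+1)/2\<close> to \<open>(m+1)/2\<close>, so adding any of \<open>0, ..., m\<close>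
    stays inside. These \<open>m + 1\<close> values are one more than the degree.\<close>
  define k where "k b = \<lceil>- (real m + 1) / 2 - r b\<rceil>" for b
  define C where "C b = real_of_int ` {k b..k b + int m}" for b
  have C: "finite (C b) \<and> card (C b) > m" for b
    by (auto simp: C_def card_image inj_on_def)
  have "\<exists>c. (\<forall>b\<in>B. c b \<in> C b) \<and> mpoly_eval P (y + (\<Sum>b\<in>B. c b *\<^sub>R b)) \<noteq> 0"
  proof (rule ccontr)
    assume *: "\<not> ?thesis"
    have "mpoly_eval P x = 0" for x
    proof -
      have "mpoly_eval P (y + (\<Sum>b\<in>B. representation B (x - y) b *\<^sub>R b)) = 0"
        by (rule vanishing_on_grid_imp_vanishing_on_span[where C = C and m = m])
           (use fB C * mpoly_eval_on_line[of P] in \<open>unfold m_def, blast+\<close>)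
      then show ?thesis by (simp flip: rep)
    qed
    then show False using mpoly_eval_not_identically_zero[OF \<open>P \<noteq> 0\<close>] by simp
  qed
  then obtain c where c: "\<And>b. b \<in> B \<Longrightarrow> c b \<in> C b"
    and nz: "mpoly_eval P (y + (\<Sum>b\<in>B. c b *\<^sub>R b)) \<noteq> 0" by blast
  define z where "z = y + (\<Sum>b\<in>B. c b *\<^sub>R b)"
  have "z - y = (\<Sum>b\<in>B. of_int \<lfloor>c b\<rfloor> *\<^sub>R b)"
  proof -
    have "c b = of_int \<lfloor>c b\<rfloor>" if "b \<in> B" for b using c[OF that] by (auto simp: C_def)
    then show ?thesis unfolding z_def by simp
  qed
  then have "z - y \<in> int_span B"
    unfolding int_span_def by (intro CollectI exI conjI) auto
  moreover have "infnorm z \<le> real CARD('n) * ((real m + 1) / 2 * \<mu>)"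
  proof -
    have z: "z = (\<Sum>b\<in>B. (r b + c b) *\<^sub>R b)"
      unfolding z_def r_def by (subst rep[of y]) (simp add: scaleR_add_left sum.distrib)
    have tri: "infnorm (\<Sum>b\<in>G. f b) \<le> (\<Sum>b\<in>G. infnorm (f b))" for f :: "real^'n \<Rightarrow> real^'n" and G
    proof (induction G rule: infinite_finite_induct)
      case (insert b G)
      then show ?case using infnorm_triangle[of "f b" "sum f G"] by simp
    qed (auto simp: infnorm_0)
    have "infnorm z \<le> (\<Sum>b\<in>B. infnorm ((r b + c b) *\<^sub>R b))"
      unfolding z by (rule tri)
    also have "\<dots> \<le> (\<Sum>b\<in>B. (real m + 1) / 2 * \<mu>)"
    proof (rule sum_mono)
      fix b assume b: "b \<in> B"
      have "real_of_int (k b) \<le> c b" "c b \<le> real_of_int (k b) + real m"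
        using c[OF b] by (auto simp: C_def)
      moreover have "- (real m + 1) / 2 - r b \<le> real_of_int (k b)"
          "real_of_int (k b) < - (real m + 1) / 2 - r b + 1"
        unfolding k_def by linarith+
      ultimately have "\<bar>r b + c b\<bar> \<le> (real m + 1) / 2"
        unfolding abs_le_iff by (auto simp: field_simps)
      then show "infnorm ((r b + c b) *\<^sub>R b) \<le> (real m + 1) / 2 * \<mu>"
        unfolding infnorm_mul using \<mu>[OF b] by (intro mult_mono) (auto simp: infnorm_pos_le)
    qed
    finally show ?thesis by (simp add: cB)
  qed
  moreover have "mpoly_eval P z \<noteq> 0" using nz by (simp add: z_def)
  ultimately show thesis using that unfolding m_def by blast
qed

theorem theorem1p1:
  fixes \<Omega> \<Lambda> :: "(real^'n) set" and \<Lambda>s :: "nat \<Rightarrow> (real^'n) set"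
    and Ds :: "nat \<Rightarrow> nat" and D s m :: nat and \<Delta> :: real
    and P :: "'n real_mpoly"
  assumes "CARD('n) \<ge> 2"
    and "is_lattice \<Omega>" and "dim \<Omega> = CARD('n)"
    and "\<Delta> = lattice_det \<Omega>"
    and "s \<ge> 1"
    and "\<And>i. i \<in> {1..s} \<Longrightarrow> sublattice_of_index (\<Lambda>s i) \<Omega> (Ds i)"
    and "\<And>i. i \<in> {1..s} \<Longrightarrow> Ds i \<ge> 2"
    and "\<not> \<Omega> \<subseteq> (\<Union>i\<in>{1..s}. \<Lambda>s i)"
    and "\<Lambda> = (\<Inter>i\<in>{1..s}. \<Lambda>s i)"
    and "D = (\<Prod>i\<in>{1..s}. Ds i)"
    and "P \<noteq> 0" and "mpoly_degree P = m"
  shows "\<exists>z \<in> \<Omega> - (\<Union>i\<in>{1..s}. \<Lambda>s i).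
     mpoly_eval P z \<noteq> 0 \<and>
     infnorm z \<le>
       (real CARD('n) * (real D * (real m + 2) + 2) * real D * \<Delta>)
         / (2 * successive_minimum 1 \<Lambda> ^ (CARD('n) - 1))
       * max 1 (2 ^ CARD('n) / measure lebesgue (sup_cube 1 :: (real^'n) set)
           * ((\<Sum>i\<in>{1..s}. 1 / real (Ds i)) - (real s - 1) / real D
              + successive_minimum 1 \<Lambda> ^ CARD('n) / (real D * \<Delta>)))"
    (is "\<exists>z\<in>_. _ \<and> infnorm z \<le> ?R * max 1 ?M")
proof -
  define B where "B = (SOME B. lattice_basis B \<Omega>)"
  have "lattice_basis B \<Omega>"
    unfolding B_def using assms(2) unfolding is_lattice_def by (rule someI_ex)
  then have B: "independent B" and \<Omega>: "\<Omega> = int_span B" by (auto simp: lattice_basis_def)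
  have \<Delta>: "\<Delta> = measure lebesgue (fundamental_parallelepiped B)"
    using assms(4) by (simp add: lattice_det_def B_def)
  have "\<Omega> \<subseteq> span B"
    unfolding \<Omega> int_span_def by (auto intro!: span_sum intro: span_scale span_base)
  moreover have span\<Omega>: "span \<Omega> = UNIV" using assms(3) dim_eq_full[of \<Omega>] by simp
  ultimately have sB: "span B = UNIV" by (metis span_mono span_span top.extremum_unique)
  have sub\<Omega>: "additive_subgroup \<Omega>" unfolding \<Omega> by (rule additive_subgroup_int_span)
  have sub\<Lambda>s: "additive_subgroup (\<Lambda>s i)" if "i \<in> {1..s}" for i
    using assms(6)[OF that] additive_subgroup_int_span
    by (auto simp: sublattice_of_index_def is_lattice_def lattice_basis_def)
  have sub\<Lambda>: "additive_subgroup \<Lambda>"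
    unfolding assms(9) using sub\<Lambda>s by (auto simp: additive_subgroup_def)
  have \<Lambda>\<Omega>: "\<Lambda> \<subseteq> \<Omega>"
    using assms(6)[of 1] assms(5) unfolding assms(9) by (auto simp: sublattice_of_index_def)
  obtain W where W: "finite W" "card W \<le> D" "\<Omega> \<subseteq> (\<Union>w\<in>W. (+) w ` \<Lambda>)"
  proof (rule common_coset_representatives[of "{1..s}" \<Lambda>s \<Omega>])
    fix W assume *: "finite W" "card W \<le> (\<Prod>i\<in>{1..s}. card (lattice_cosets \<Omega> (\<Lambda>s i)))"
      "\<Omega> \<subseteq> (\<Union>w\<in>W. (+) w ` (\<Inter>i\<in>{1..s}. \<Lambda>s i))"
    have "(\<Prod>i\<in>{1..s}. card (lattice_cosets \<Omega> (\<Lambda>s i))) = D"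
      unfolding assms(10) using assms(6) by (intro prod.cong) (auto simp: sublattice_of_index_def)
    with * show thesis by (intro that) (auto simp: assms(9))
  qed (use assms(6) sub\<Lambda>s in \<open>auto simp: sublattice_of_index_def\<close>)
  \<comment> \<open>Finite index in \<Omega> forces full rank.\<close>
  have span\<Lambda>: "span \<Lambda> = UNIV"
    using finite_index_subset_span[OF sub\<Omega> sub\<Lambda> W(1,3)] span\<Omega>
    by (metis span_mono span_span top.extremum_unique)
  have fin: "finite (sup_cube T \<inter> \<Lambda>)" for T
    by (rule finite_subset[OF _ finite_bounded_int_span[OF B bounded_sup_cube]]) (use \<Lambda>\<Omega> \<Omega> in auto)
  obtain \<mu> a where \<mu>: "span (sup_cube \<mu> \<inter> \<Lambda>) = UNIV" and "a \<noteq> 0"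
    and a: "\<And>v. v \<in> \<Lambda> \<Longrightarrow> infnorm v < \<mu> \<Longrightarrow> a \<bullet> v = 0"
    using last_minimum_exists[OF fin span\<Lambda>] by blast
  obtain V where V: "V \<subseteq> sup_cube \<mu> \<inter> \<Lambda>" "independent V" "sup_cube \<mu> \<inter> \<Lambda> \<subseteq> span V"
    using maximal_independent_subset by blast
  have sV: "span V = UNIV" using V(3) \<mu> by (metis span_mono span_span top.extremum_unique)
  have "V \<noteq> {}"
  proof
    assume "V = {}"
    then have "a \<in> {0}" using sV by simp
    with \<open>a \<noteq> 0\<close> show False by simp
  qed
  then obtain w where "w \<in> V" by blast
  then have w: "w \<in> \<Lambda>" "w \<noteq> 0" "infnorm w \<le> \<mu>"
    using V(1,2) dependent_zero[of V] by (auto simp: sup_cube_def)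
  define \<kappa> where "\<kappa> = successive_minimum 1 \<Lambda>"
  note \<kappa> = successive_minimum_1[OF fin w(1,2), folded \<kappa>_def]
  \<comment> \<open>\<open>card W\<close> takes the place of the index of \<Lambda> in \<Omega>; the
    bound \<open>card W \<le> D\<close> then suffices.\<close>
  have "\<mu> * \<kappa> ^ (CARD('n) - 1) \<le> card W * \<Delta>"
  proof (rule first_last_minimum_le)
    show "\<kappa> \<le> \<mu>" using \<kappa>(2)[OF w(1,2)] w(3) by simp
    fix S :: "(real^'n) set"
    assume "S \<in> lmeasurable" "bounded S" "\<And>x y. x \<in> S \<Longrightarrow> y \<in> S \<Longrightarrow> x - y \<in> \<Lambda> \<Longrightarrow> x = y"
    then show "measure lebesgue S \<le> card W * \<Delta>"
      unfolding \<Delta> using B sB sub\<Lambda> \<Lambda>\<Omega> W \<Omega> by (intro measure_packing_le[where L = \<Lambda>]) auto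
  qed (use \<kappa> a \<open>a \<noteq> 0\<close> in auto)
  also have "\<dots> \<le> D * \<Delta>" using W(2) by (intro mult_right_mono) (auto simp: \<Delta>)
  finally have \<mu>_le: "\<mu> \<le> D * \<Delta> / \<kappa> ^ (CARD('n) - 1)"
    using \<kappa>(1) by (simp add: field_simps)
  obtain y where y: "y \<in> \<Omega>" "y \<notin> (\<Union>i\<in>{1..s}. \<Lambda>s i)" using assms(8) by blast
  obtain z where z: "z - y \<in> int_span V" "mpoly_eval P z \<noteq> 0"
      "infnorm z \<le> real CARD('n) * ((real m + 1) / 2 * \<mu>)"
    using nonzero_point_in_translated_lattice[OF V(2) sV, of \<mu> P y] V(1) assms(11,12)
    by (auto simp: sup_cube_def)
  have zy: "z - y \<in> \<Lambda>"
    using z(1) V(1) unfolding int_span_def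
    by (auto intro!: additive_subgroup_sum[OF sub\<Lambda>] additive_subgroup_of_int_scaleR[OF sub\<Lambda>])
  show ?thesis
  proof (intro bexI conjI)
    show "mpoly_eval P z \<noteq> 0" by fact
    have "z \<in> \<Omega>" using additive_subgroup_add[OF sub\<Omega> y(1), of "z - y"] zy \<Lambda>\<Omega> by auto
    \<comment> \<open>Since \<open>z - y\<close> lies in every \<open>\<Lambda>s i\<close>,
      membership of \<open>z\<close> would pass to \<open>y\<close>.\<close>
    moreover have "z \<notin> \<Lambda>s i" if i: "i \<in> {1..s}" for i
    proof
      assume "z \<in> \<Lambda>s i"
      moreover have "z - y \<in> \<Lambda>s i" using zy i by (auto simp: assms(9))
      ultimately have "z - (z - y) \<in> \<Lambda>s i" using sub\<Lambda>s[OF i] unfolding additive_subgroup_def by blast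
      then show False using y(2) i by auto
    qed
    ultimately show "z \<in> \<Omega> - (\<Union>i\<in>{1..s}. \<Lambda>s i)" by blast
    let ?q = "D * \<Delta> / \<kappa> ^ (CARD('n) - 1)"
    have "?q \<ge> 0" using \<kappa>(1) by (auto simp: \<Delta>)
    have "D > 0" unfolding assms(10) using assms(7) by (intro prod_pos) fastforce
    then have "real D \<ge> 1" by simp
    \<comment> \<open>The construction yields \<open>d * (m + 1) / 2 * ?q\<close>. The stated bound
      is at least this, because \<open>D \<ge> 1\<close> enlarges the first factor and the maximum
      is at least 1.\<close>
    then have "1 * (real m + 1) \<le> real D * (real m + 2)"
      by (intro mult_mono) auto
    then have *: "(real m + 1) / 2 \<le> (real D * (real m + 2) + 2) / 2"
      by (intro divide_right_mono add_increasing2) auto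
    note z(3)
    also have "real CARD('n) * ((real m + 1) / 2 * \<mu>)
        \<le> real CARD('n) * ((real m + 1) / 2 * ?q)"
      using \<mu>_le by (intro mult_left_mono) auto
    also have "\<dots> \<le> real CARD('n) * ((real D * (real m + 2) + 2) / 2 * ?q)"
      using * \<open>?q \<ge> 0\<close> by (intro mult_left_mono mult_right_mono) auto
    also have "\<dots> = ?R" by (simp add: \<kappa>_def)
    also have "\<dots> \<le> ?R * max 1 ?M"
    proof -
      have "?R \<ge> 0" using \<kappa>(1) by (auto simp: \<Delta> \<kappa>_def intro!: divide_nonneg_pos mult_nonneg_nonneg)
      then show ?thesis using mult_left_mono[of 1 "max 1 ?M" ?R] by simp
    qed
    finally show "infnorm z \<le> ?R * max 1 ?M" .
  qed
qed

end
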